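(* Let $\{e\}$ be a basis of a $1$-dimensional vector space $A$ over $\mathbb{C}$. The only Rota-Baxter operator on the Jordan algebra $(A,\circ_1)$ given by $e\circ_1 e=e$ is zero, and the Rota-Baxter operators on the Jordan algebra $(A,\circ_2)$ given by $e\circ_2 e=0$ are all linear maps $A\to A$. In both cases the induced pre-Jordan algebra is the one given by $e\cdot e=0$.
   Context: A Rota-Baxter operator (of weight $0$) on a Jordan algebra $(J,\circ)$ is a linear map $R:J\to J$ with $R(x)\circ R(y)=R(R(x)\circ y+x\circ R(y))$ for all $x,y\in J$. The pre-Jordan algebra induced by $R$ is $J$ with the multiplication $x\cdot y:=R(x)\circ y$. *)

theory Defs
  imports Complex_Main
begin

locale complex_algebra = vector_space scale
  for scale :: "complex \<Rightarrow> 'a::ab_group_add \<Rightarrow> 'a" +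
  fixes mult :: "'a \<Rightarrow> 'a \<Rightarrow> 'a"
  assumes linear_left: "Vector_Spaces.linear scale scale (\<lambda>x. mult x y)"
    and linear_right: "Vector_Spaces.linear scale scale (\<lambda>y. mult x y)"

definition (in complex_algebra) jprod :: "'a \<Rightarrow> 'a \<Rightarrow> 'a" where
  "jprod x y = mult x y + mult y x"

locale jordan_algebra = complex_algebra +
  assumes commute: "mult x y = mult y x"
    and jordan_identity:
      "mult (mult x y) (mult x x) = mult x (mult y (mult x x))"

text \<open>
  With \<open>x \<circ> y = jprod x y\<close>, the two axioms say that left multiplication is a
  representation of the Jordan algebra \<open>(A, \<circ>)\<close> on \<open>A\<close>.
\<close>
locale pre_jordan_algebra = complex_algebra +
  assumes pre_jordan_1:
    "mult (jprod x y) (mult z u) + mult (jprod y z) (mult x u) + mult (jprod z x) (mult y u)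
     = mult z (mult (jprod x y) u) + mult x (mult (jprod y z) u) + mult y (mult (jprod z x) u)"
    and pre_jordan_2:
    "mult x (mult y (mult z u)) + mult z (mult y (mult x u)) + mult (jprod (jprod x z) y) u
     = mult z (mult (jprod x y) u) + mult x (mult (jprod y z) u) + mult y (mult (jprod z x) u)"

locale rota_baxter_operator = jordan_algebra +
  fixes R :: "'a \<Rightarrow> 'a"
  assumes linear: "Vector_Spaces.linear scale scale R"
    and rota_baxter: "mult (R x) (R y) = R (mult (R x) y + mult x (R y))"

definition induced_mult :: "('a \<Rightarrow> 'a \<Rightarrow> 'a) \<Rightarrow> ('a \<Rightarrow> 'a) \<Rightarrow> 'a \<Rightarrow> 'a \<Rightarrow> 'a" where
  "induced_mult mult R x y = mult (R x) y"

definition is_basis :: "(complex \<Rightarrow> 'a::ab_group_add \<Rightarrow> 'a) \<Rightarrow> 'a set \<Rightarrow> bool" where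
  "is_basis scale B \<longleftrightarrow> \<not> module.dependent scale B \<and> module.span scale B = UNIV"

text \<open>The algebra structure given by \<open>e \<cdot> e = a\<close>, extended bilinearly from the basis \<open>{e}\<close>.\<close>
definition algebra_given_by ::
  "(complex \<Rightarrow> 'a::ab_group_add \<Rightarrow> 'a) \<Rightarrow> 'a \<Rightarrow> 'a \<Rightarrow> ('a \<Rightarrow> 'a \<Rightarrow> 'a) \<Rightarrow> bool" where
  "algebra_given_by scale e a mult \<longleftrightarrow> complex_algebra scale mult \<and> mult e e = a"

lemma algebra_given_by_ex1:
  assumes "vector_space scale" and "is_basis scale {e}"
  shows "\<exists>!mult. algebra_given_by scale e a mult"
proof -
  interpret vector_space scale by fact
  have ind: "independent {e}" and sp: "span {e} = UNIV"
    using assms(2) by (auto simp: is_basis_def)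
  have e0: "e \<noteq> 0" using ind dependent_zero by auto
  have "\<exists>k. x = scale k e" for x
    using sp span_singleton[of e] by blast
  then obtain c where c: "\<And>x. x = scale (c x) e" by metis
  have c_eq: "c x = k" if "x = scale k e" for x k
    using c[of x] that e0 by (metis scale_right_imp_eq)
  have c_add: "c (x + y) = c x + c y" for x y
    by (rule c_eq) (metis c scale_left_distrib)
  have c_scale: "c (scale k x) = k * c x" for k x
    by (rule c_eq) (metis c scale_scale)
  have c_e: "c e = 1" by (rule c_eq) simp
  show ?thesis
  proof (rule ex1I[where a = "\<lambda>x y. scale (c x * c y) a"])
    show "algebra_given_by scale e a (\<lambda>x y. scale (c x * c y) a)"
      unfolding algebra_given_by_def
      by (auto simp: complex_algebra_def complex_algebra_axioms_def Vector_Spaces.linear_iff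
          vector_space_axioms c_add c_scale c_e algebra_simps)
  next
    fix m assume "algebra_given_by scale e a m"
    then have m: "complex_algebra scale m" and me: "m e e = a"
      by (auto simp: algebra_given_by_def)
    interpret m: complex_algebra scale m by fact
    have "m x y = scale (c x * c y) a" for x y
    proof -
      have "m x y = m (scale (c x) e) (scale (c y) e)" using c by metis
      also have "\<dots> = scale (c x) (m e (scale (c y) e))"
        using m.linear_left by (simp add: Vector_Spaces.linear_iff)
      also have "m e (scale (c y) e) = scale (c y) (m e e)"
        using m.linear_right by (simp add: Vector_Spaces.linear_iff)
      finally show ?thesis by (simp add: me)
    qed
    then show "m = (\<lambda>x y. scale (c x * c y) a)" by blast
  qed
qed

end

theory Submission
  imports Defs
begin

text \<open>
  On a line spanned by \<open>e\<close>, a bilinear multiplication is scalar multiplication by the two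
  coordinates followed by \<open>e \<cdot> e\<close>, so it is commutative, the Jordan identity holds
  because both sides have the same coordinates, and the multiplication is zero
  once \<open>e \<cdot> e = 0\<close> (\<open>jordan_algebra_if_singleton_basis\<close>,
  \<open>mult_eq_zero_if_singleton_basis\<close>). For the zero multiplication the Rota-Baxter
  identity reads \<open>0 = R 0\<close>, so only linearity of \<open>R\<close> remains.

  If \<open>e \<circ> e = e\<close> and \<open>R e = r e\<close>, the Rota-Baxter identity at \<open>(e, e)\<close> compares
  \<open>r\<^sup>2 e\<close> with \<open>R (2 r e) = 2 r\<^sup>2 e\<close>. Weight \<open>0\<close> thus forces \<open>r\<^sup>2 = 2 r\<^sup>2\<close>, hence
  \<open>r = 0\<close> (\<open>eq_zero_if_idempotent_basis\<close>). In both cases the induced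
  multiplication \<open>R x \<circ> y\<close> vanishes identically, either because \<open>R\<close> does or because \<open>\<circ>\<close> does, and the zero multiplication
  satisfies the pre-Jordan identities trivially.
\<close>

lemma singleton_basis_nonzero:
  assumes "vector_space scale" and "is_basis scale {e}"
  shows "e \<noteq> 0"
proof -
  interpret vector_space scale by fact
  show ?thesis using assms(2) dependent_zero by (auto simp: is_basis_def)
qed

lemma singleton_basis_coordinate:
  assumes "vector_space scale" and "is_basis scale {e}"
  obtains k where "x = scale k e"
proof -
  interpret vector_space scale by fact
  show ?thesis using that assms(2) span_singleton[of e] by (auto simp: is_basis_def)
qed

context complex_algebra
begin

lemma mult_scale_left: "mult (scale k x) y = scale k (mult x y)"
  using linear_left by (simp add: Vector_Spaces.linear_iff)

lemma mult_scale_right: "mult x (scale k y) = scale k (mult x y)"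
  using linear_right by (simp add: Vector_Spaces.linear_iff)

lemma mult_zero_left: "mult 0 y = 0"
  using mult_scale_left[of 0 0 y] by simp

text \<open>
  For \<open>x = h e\<close> and \<open>y = k e\<close>, both sides of the Jordan identity are \<open>h\<^sup>3 k\<close> times a product of four factors \<open>e\<close>, and the two ways of bracketing these agree
  since \<open>e \<cdot> e\<close> is itself a multiple of \<open>e\<close>.
\<close>
lemma jordan_algebra_if_singleton_basis:
  assumes "is_basis scale {e}"
  shows "jordan_algebra scale mult"
proof unfold_locales
  obtain a where a: "mult e e = scale a e"
    using singleton_basis_coordinate[OF vector_space_axioms assms] .
  note normalize = mult_scale_left mult_scale_right a mult_ac
  fix x y
  obtain h where h: "x = scale h e"
    using singleton_basis_coordinate[OF vector_space_axioms assms] .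
  obtain k where k: "y = scale k e"
    using singleton_basis_coordinate[OF vector_space_axioms assms] .
  show "mult x y = mult y x"
    by (simp add: h k normalize)
  show "mult (mult x y) (mult x x) = mult x (mult y (mult x x))"
    by (simp add: h k normalize)
qed

lemma mult_eq_zero_if_singleton_basis:
  assumes "is_basis scale {e}" and "mult e e = 0"
  shows "mult = (\<lambda>x y. 0)"
proof (intro ext)
  fix x y
  obtain h where h: "x = scale h e"
    using singleton_basis_coordinate[OF vector_space_axioms assms(1)] .
  obtain k where k: "y = scale k e"
    using singleton_basis_coordinate[OF vector_space_axioms assms(1)] .
  show "mult x y = 0"
    by (simp add: h k mult_scale_left mult_scale_right assms(2))
qed

end

lemma linear_zero:
  assumes "vector_space scale"
  shows "Vector_Spaces.linear scale scale (\<lambda>x. 0)"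
proof -
  interpret vector_space scale by fact
  show ?thesis by (simp add: Vector_Spaces.linear_iff vector_space_axioms)
qed

lemma complex_algebra_zero_mult:
  assumes "vector_space scale"
  shows "complex_algebra scale (\<lambda>x y. 0)"
  using assms by (simp add: complex_algebra_def complex_algebra_axioms_def linear_zero)

lemma pre_jordan_algebra_zero_mult:
  assumes "vector_space scale"
  shows "pre_jordan_algebra scale (\<lambda>x y. 0)"
  using complex_algebra_zero_mult[OF assms]
  by (simp add: pre_jordan_algebra_def pre_jordan_algebra_axioms_def)

lemma (in jordan_algebra) rota_baxter_operator_zero: "rota_baxter_operator scale mult (\<lambda>x. 0)"
  by unfold_locales (simp_all add: linear_zero[OF vector_space_axioms] mult_zero_left)

lemma rota_baxter_operator_zero_mult_iff:
  assumes "jordan_algebra scale (\<lambda>x y. 0)"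
  shows "rota_baxter_operator scale (\<lambda>x y. 0) R \<longleftrightarrow> Vector_Spaces.linear scale scale R"
proof -
  interpret jordan_algebra scale "\<lambda>x y. 0" by fact
  have "R 0 = 0" if "Vector_Spaces.linear scale scale R"
    using that scale_zero_left by (metis Vector_Spaces.linear_iff)
  then show ?thesis
    using assms by (auto simp: rota_baxter_operator_def rota_baxter_operator_axioms_def)
qed

text \<open>
  An idempotent \<open>e\<close> that is an eigenvector of \<open>R\<close> gives \<open>r\<^sup>2 = 2 r\<^sup>2\<close> for its eigenvalue
  \<open>r\<close>; on a line every vector is an eigenvector, and \<open>R\<close> is determined by \<open>R e\<close>.
\<close>
lemma (in rota_baxter_operator) eq_zero_if_idempotent_basis:
  assumes basis: "is_basis scale {e}" and idem: "mult e e = e"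
  shows "R = (\<lambda>x. 0)"
proof -
  have R_scale: "R (scale k x) = scale k (R x)" for k x
    using linear by (simp add: Vector_Spaces.linear_iff)
  obtain r where r: "R e = scale r e"
    using singleton_basis_coordinate[OF vector_space_axioms basis] .
  have "scale (r * r) e = mult (R e) (R e)"
    by (simp add: r mult_scale_left mult_scale_right idem)
  also have "\<dots> = R (mult (R e) e + mult e (R e))"
    by (rule rota_baxter)
  also have "\<dots> = R (scale (r + r) e)"
    by (simp add: r mult_scale_left mult_scale_right idem flip: scale_left_distrib)
  also have "\<dots> = scale ((r + r) * r) e"
    by (simp add: R_scale r)
  finally have "r * r = (r + r) * r"
    using singleton_basis_nonzero[OF vector_space_axioms basis] by simp
  then have "r = 0"
    by (simp add: distrib_right)
  show ?thesis
  proof (intro ext)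
    fix x
    obtain k where "x = scale k e"
      using singleton_basis_coordinate[OF vector_space_axioms basis] .
    then show "R x = 0"
      by (simp add: R_scale r \<open>r = 0\<close>)
  qed
qed

theorem proposition5p3:
  fixes scale :: "complex \<Rightarrow> 'a::ab_group_add \<Rightarrow> 'a"
    and e :: 'a
    and mult1 mult2 :: "'a \<Rightarrow> 'a \<Rightarrow> 'a"
  assumes "vector_space scale"
    and "is_basis scale {e}"
    and "algebra_given_by scale e e mult1"
    and "algebra_given_by scale e 0 mult2"
  shows "jordan_algebra scale mult1
    \<and> jordan_algebra scale mult2
    \<and> (\<forall>R. rota_baxter_operator scale mult1 R \<longleftrightarrow> R = (\<lambda>x. 0))
    \<and> (\<forall>R. rota_baxter_operator scale mult2 R \<longleftrightarrow> Vector_Spaces.linear scale scale R)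
    \<and> (\<forall>mult \<in> {mult1, mult2}. \<forall>R. rota_baxter_operator scale mult R \<longrightarrow>
          pre_jordan_algebra scale (induced_mult mult R)
          \<and> algebra_given_by scale e 0 (induced_mult mult R))"
proof -
  interpret A1: complex_algebra scale mult1
    using assms(3) by (simp add: algebra_given_by_def)
  interpret A2: complex_algebra scale mult2
    using assms(4) by (simp add: algebra_given_by_def)
  have idem: "mult1 e e = e" and null: "mult2 e e = 0"
    using assms(3,4) by (simp_all add: algebra_given_by_def)
  interpret J1: jordan_algebra scale mult1
    by (rule A1.jordan_algebra_if_singleton_basis[OF assms(2)])
  interpret J2: jordan_algebra scale mult2
    by (rule A2.jordan_algebra_if_singleton_basis[OF assms(2)])
  have mult2: "mult2 = (\<lambda>x y. 0)"
    by (rule A2.mult_eq_zero_if_singleton_basis[OF assms(2) null])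
  have RB1: "rota_baxter_operator scale mult1 R \<longleftrightarrow> R = (\<lambda>x. 0)" for R
    using rota_baxter_operator.eq_zero_if_idempotent_basis[of scale mult1 R e] assms(2) idem
      J1.rota_baxter_operator_zero by blast
  have RB2: "rota_baxter_operator scale mult2 R \<longleftrightarrow> Vector_Spaces.linear scale scale R" for R
    using rota_baxter_operator_zero_mult_iff J2.jordan_algebra_axioms unfolding mult2 by blast
  have induced: "induced_mult mult R = (\<lambda>x y. 0)"
    if "mult \<in> {mult1, mult2}" "rota_baxter_operator scale mult R" for mult R
  proof (intro ext)
    fix x y
    show "induced_mult mult R x y = 0"
      using that RB1 A1.mult_zero_left by (auto simp: induced_mult_def mult2)
  qed
  have "algebra_given_by scale e 0 (\<lambda>x y. 0)"
    using complex_algebra_zero_mult[OF assms(1)] by (simp add: algebra_given_by_def)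
  then show ?thesis
    using J1.jordan_algebra_axioms J2.jordan_algebra_axioms RB1 RB2 induced
      pre_jordan_algebra_zero_mult[OF assms(1)] by simp
qed

end
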